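(* Let $k_1,k_2$ be positive integers and let $D$ be a digraph with $\delta^+(D)\geq 2(k_1+k_2)-1$. Then $D$ contains a subdivision of $C(k_1,k_2)$.
   Context: $\delta^+(D)$ is the minimum out-degree. $C(k_1,k_2)$ is the digraph that is the union of two internally disjoint directed paths, one of length $k_1$ and one of length $k_2$, having the same initial vertex and the same terminal vertex. A subdivision of a digraph $F$ is obtained by replacing each arc $(x,y)$ by a directed $(x,y)$-path, these paths being internally disjoint with new internal vertices; "contains" means as a subdigraph. *)

theory Defs
  imports Main
begin

definition digraph :: "'a set \<Rightarrow> ('a \<times> 'a) set \<Rightarrow> bool" where
  "digraph V E \<longleftrightarrow> finite V \<and> V \<noteq> {} \<and> E \<subseteq> V \<times> V \<and> (\<forall>v. (v, v) \<notin> E)"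

definition out_degree :: "('a \<times> 'a) set \<Rightarrow> 'a \<Rightarrow> nat" where
  "out_degree E v = card {w. (v, w) \<in> E}"

definition min_out_degree :: "'a set \<Rightarrow> ('a \<times> 'a) set \<Rightarrow> nat" where
  "min_out_degree V E = Min (out_degree E ` V)"

definition dipath :: "'a set \<Rightarrow> ('a \<times> 'a) set \<Rightarrow> 'a list \<Rightarrow> bool" where
  "dipath V E P \<longleftrightarrow> P \<noteq> [] \<and> distinct P \<and> set P \<subseteq> V \<and>
     (\<forall>i. Suc i < length P \<longrightarrow> (P ! i, P ! Suc i) \<in> E)"

definition path_len :: "'a list \<Rightarrow> nat" where
  "path_len P = length P - 1"

text \<open>D contains a subdivision of C(k1,k2): there are vertices x \<noteq> y and two
internally disjoint (distinct) directed (x,y)-paths, one of length at least k1 and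
one of length at least k2 (the subdivision of an arc is a path, so path lengths
can only grow).\<close>
definition contains_subdiv_C :: "'a set \<Rightarrow> ('a \<times> 'a) set \<Rightarrow> nat \<Rightarrow> nat \<Rightarrow> bool" where
  "contains_subdiv_C V E k1 k2 \<longleftrightarrow>
     (\<exists>x y P1 P2. x \<noteq> y \<and> dipath V E P1 \<and> dipath V E P2 \<and> P1 \<noteq> P2 \<and>
        hd P1 = x \<and> last P1 = y \<and> hd P2 = x \<and> last P2 = y \<and>
        set P1 \<inter> set P2 = {x, y} \<and>
        path_len P1 \<ge> k1 \<and> path_len P2 \<ge> k2)"

end

theory Submission
  imports Defs
begin

text \<open>Call a path \<open>P @ [x]\<close> with two disjoint paths \<open>x # Q1\<close>, \<open>x # Q2\<close> of lengths \<open>k1\<close>, \<open>k2\<close>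
starting at its end a fork, and take a fork with longest stem \<open>P\<close>. Let \<open>T\<close> consist of \<open>x\<close> and the
two branches, and let \<open>S1\<close>, \<open>S2\<close> be the sets of vertices reachable from the ends \<open>b1\<close>, \<open>b2\<close> of the
branches without entering \<open>T\<close> again. If \<open>S1\<close> and \<open>S2\<close> meet, the two branches can be prolonged to the
desired subdivision. They do meet if both contain vertices of \<open>P\<close>: follow \<open>P\<close> from the earlier
one to the later one. Otherwise, by symmetry, \<open>S1\<close> avoids \<open>P\<close>, so all out-neighbours of \<open>S1\<close> lie in
\<open>S1 \<union> T\<close>. Every vertex of \<open>S1\<close> then has at least \<open>k1 + k2 - 1\<close> out-neighbours in \<open>S1\<close> and at least
\<open>k1 + k2\<close> in \<open>S1 \<union> Q2\<close>, which is enough to build greedily a new fork rooted at \<open>b1\<close> that avoids \<open>P\<close>,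
\<open>x\<close> and the rest of \<open>Q1\<close>, and whose stem is longer by \<open>k1\<close>.\<close>

abbreviation walk :: "('a \<times> 'a) set \<Rightarrow> 'a list \<Rightarrow> bool" where
  "walk r \<equiv> successively (\<lambda>u v. (u, v) \<in> r)"

lemma dipath_iff_walk:
  "dipath V E P \<longleftrightarrow> P \<noteq> [] \<and> distinct P \<and> set P \<subseteq> V \<and> walk E P"
  by (simp add: dipath_def successively_conv_nth)

lemma walk_set_subset_reachable:
  "walk r (u # W) \<Longrightarrow> set W \<subseteq> r\<^sup>* `` {u}"
proof (induction W arbitrary: u)
  case (Cons w W)
  then have "(u, w) \<in> r" "set W \<subseteq> r\<^sup>* `` {w}" by auto
  then show ?case by (auto intro: converse_rtrancl_into_rtrancl)
qed simp

lemma walk_set_subset_Range: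
  "walk r (u # W) \<Longrightarrow> set W \<subseteq> Range r"
  by (induction W arbitrary: u) auto

lemma walk_mono: "walk r W \<Longrightarrow> r \<subseteq> s \<Longrightarrow> walk s W"
  by (auto elim: successively_mono)

text \<open>Induction on reachability from the front: a new start in \<open>A\<close> is a walk by
  itself, and if the new start already lies on the walk found so far, everything before that
  occurrence is cut off.\<close>

lemma reachable_first_hit:
  assumes "(u, z) \<in> r\<^sup>*" "z \<in> A"
  obtains W where "walk r (u # W)" "distinct (u # W)" "last (u # W) \<in> A"
    "set (butlast (u # W)) \<inter> A = {}"
proof -
  have "\<exists>W. walk r (u # W) \<and> distinct (u # W) \<and> last (u # W) \<in> A \<and>
    set (butlast (u # W)) \<inter> A = {}"
    using assms(1)
  proof (induction rule: converse_rtrancl_induct)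
    case base
    show ?case using assms(2) by (intro exI[of _ "[]"]) simp
  next
    case (step y y')
    then obtain W where W: "walk r (y' # W)" "distinct (y' # W)" "last (y' # W) \<in> A"
      "set (butlast (y' # W)) \<inter> A = {}" by blast
    consider "y \<in> A" | "y \<notin> A" "y \<in> set (y' # W)" | "y \<notin> A" "y \<notin> set (y' # W)" by blast
    then show ?case
    proof cases
      case 1
      then show ?thesis by (intro exI[of _ "[]"]) simp
    next
      case 2
      then obtain W1 W2 where s: "y' # W = W1 @ y # W2" by (meson split_list)
      show ?thesis
        using W unfolding s
        by (intro exI[of _ W2]) (auto simp: successively_append_iff butlast_append)
    next
      case 3
      then show ?thesis using W step(1) by (intro exI[of _ "y' # W"]) auto
    qed
  qed
  then show ?thesis using that by blast
qed

text \<open>\<open>X\<close> collects the forbidden vertices, among them the current end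
  \<open>u\<close>. As \<open>u\<close> is not its own out-neighbour, at most
  \<open>card X - 1\<close> of them can block the next step, hence the bound \<open>d + 1\<close>
  instead of \<open>d\<close>.\<close>

lemma greedy_path:
  assumes "\<And>v. v \<in> S \<Longrightarrow> d \<le> card (E `` {v} \<inter> S)"
    and irr: "\<And>v. (v, v) \<notin> E"
    and "u \<in> S" "u \<in> X" "finite X" "card X + n \<le> d + 1"
  shows "\<exists>Q. length Q = n \<and> distinct Q \<and> set Q \<subseteq> S - X \<and> walk E (u # Q)"
  using assms(3-6)
proof (induction n arbitrary: u X)
  case (Suc n)
  have "0 < card X" using Suc.prems by (auto simp: card_gt_0_iff)
  then have "card (X - {u}) < d" using Suc.prems by (simp add: card_Diff_singleton)
  also have "d \<le> card (E `` {u} \<inter> S)" using assms(1) Suc.prems by blast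
  finally have "\<not> E `` {u} \<inter> S \<subseteq> X - {u}"
    using Suc.prems(3) card_mono[of "X - {u}"] by (meson finite_Diff leD)
  then obtain w where w: "(u, w) \<in> E" "w \<in> S" "w \<notin> X" using irr by auto
  have "card (insert w X) + n \<le> d + 1" using w Suc.prems by simp
  then obtain Q where "length Q = n" "distinct Q" "set Q \<subseteq> S - insert w X" "walk E (w # Q)"
    using Suc.IH[of w "insert w X"] w Suc.prems by auto
  then show ?case using w by (intro exI[of _ "w # Q"]) auto
qed simp

definition fork ::
  "'a set \<Rightarrow> ('a \<times> 'a) set \<Rightarrow> nat \<Rightarrow> nat \<Rightarrow> 'a list \<Rightarrow> 'a \<Rightarrow> 'a list \<Rightarrow> 'a list \<Rightarrow> bool" where
  "fork V E k1 k2 P x Q1 Q2 \<longleftrightarrow> length Q1 = k1 \<and> length Q2 = k2 \<and>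
     distinct (P @ x # Q1 @ Q2) \<and> set (P @ x # Q1 @ Q2) \<subseteq> V \<and>
     walk E (P @ x # Q1) \<and> walk E (x # Q2)"

lemma fork_swap: "fork V E k1 k2 P x Q1 Q2 \<Longrightarrow> fork V E k2 k1 P x Q2 Q1"
  by (auto simp: fork_def successively_append_iff)

lemma fork_exists:
  assumes E: "E \<subseteq> V \<times> V" and irr: "\<And>v. (v, v) \<notin> E"
    and deg: "\<And>v. v \<in> V \<Longrightarrow> k1 + k2 \<le> card (E `` {v})" and "x \<in> V"
  shows "\<exists>Q1 Q2. fork V E k1 k2 [] x Q1 Q2"
proof -
  have "E `` {v} \<inter> V = E `` {v}" for v using E by auto
  then have deg': "v \<in> V \<Longrightarrow> k1 + k2 \<le> card (E `` {v} \<inter> V)" for v using deg by simp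
  obtain Q1 where Q1: "length Q1 = k1" "distinct Q1" "set Q1 \<subseteq> V - {x}" "walk E (x # Q1)"
    using greedy_path[of V _ E x "{x}" k1, OF deg' irr \<open>x \<in> V\<close>] by auto
  have "card (insert x (set Q1)) = k1 + 1" using Q1 by (simp add: subset_Diff_insert distinct_card)
  then obtain Q2 where "length Q2 = k2" "distinct Q2" "set Q2 \<subseteq> V - insert x (set Q1)"
    "walk E (x # Q2)"
    using greedy_path[of V _ E x "insert x (set Q1)" k2, OF deg' irr \<open>x \<in> V\<close>] by auto
  then show ?thesis using Q1 \<open>x \<in> V\<close> by (auto simp: fork_def)
qed

text \<open>Only heads are restricted: a walk may start in \<open>T\<close>, as it does at the end
  of a branch, but cannot come back to it.\<close>

definition arcs_off :: "('a \<times> 'a) set \<Rightarrow> 'a set \<Rightarrow> ('a \<times> 'a) set" where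
  "arcs_off E T = {(u, v) \<in> E. v \<notin> T}"

lemma reachable_arcs_off: "z \<in> (arcs_off E T)\<^sup>* `` {b} \<Longrightarrow> z = b \<or> z \<notin> T"
  by (auto simp: arcs_off_def elim: rtranclE)

lemma reachable_arcs_off_subset:
  assumes "E \<subseteq> V \<times> V" "b \<in> V"
  shows "(arcs_off E T)\<^sup>* `` {b} \<subseteq> V"
  using assms by (auto simp: arcs_off_def elim: rtranclE)

lemma fork_extend:
  assumes E: "E \<subseteq> V \<times> V" and irr: "\<And>v. (v, v) \<notin> E" and "finite V"
    and deg: "\<And>v. v \<in> V \<Longrightarrow> 2 * (k1 + k2) - 1 \<le> card (E `` {v})"
    and k: "k1 \<ge> 1" "k2 \<ge> 1"
    and fork: "fork V E k1 k2 P x Q1 Q2"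
    and T: "T = insert x (set Q1 \<union> set Q2)"
    and S: "S = (arcs_off E T)\<^sup>* `` {last Q1}"
    and SP: "S \<inter> set P = {}"
  shows "\<exists>P' x' Q1' Q2'. fork V E k1 k2 P' x' Q1' Q2' \<and> length P < length P'"
proof -
  have len: "length Q1 = k1" "length Q2 = k2"
    and dist: "distinct (P @ x # Q1 @ Q2)" and sub: "set (P @ x # Q1 @ Q2) \<subseteq> V"
    and walks: "walk E (P @ x # Q1)" "walk E (x # Q2)"
    using fork by (auto simp: fork_def)
  define b where "b = last Q1"
  define A where "A = butlast Q1"
  have Q1: "Q1 = A @ [b]" using len k unfolding A_def b_def
    by (metis append_butlast_last_id list.size(3) not_one_le_zero)
  have bS: "b \<in> S" by (auto simp: S b_def)
  have ST: "S \<inter> T \<subseteq> {b}" using reachable_arcs_off by (fastforce simp: S b_def)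
  have SV: "S \<subseteq> V"
    unfolding S by (rule reachable_arcs_off_subset[OF E]) (use sub Q1 in auto)
  have "v \<in> S \<Longrightarrow> (v, w) \<in> E \<Longrightarrow> w \<in> S \<union> T" for v w
    by (auto simp: S arcs_off_def intro: rtrancl_into_rtrancl)
  then have nbr: "v \<in> S \<Longrightarrow> E `` {v} \<subseteq> S \<union> T" for v by blast
  have fin: "finite (E `` {v})" for v
    using E \<open>finite V\<close> by (auto intro: finite_subset[of _ V])
  have cA: "card (insert x (set A)) = k1"
    using dist len by (auto simp: Q1 distinct_card)
  have cAQ: "card (insert x (set A) \<union> set Q2) = k1 + k2"
    using dist len cA by (subst card_Un_disjoint) (auto simp: Q1 distinct_card)
  \<comment> \<open>Since \<open>b\<close> lies in \<open>S\<close>, an out-neighbour outside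
    \<open>S\<close> is one of the \<open>k1 + k2\<close> other vertices of
    \<open>T\<close>.\<close>
  have deg1: "k1 + k2 - 1 \<le> card (E `` {v} \<inter> S)" if "v \<in> S" for v
  proof -
    have "E `` {v} \<subseteq> (E `` {v} \<inter> S) \<union> (insert x (set A) \<union> set Q2)"
      using nbr[OF that] bS by (auto simp: T Q1)
    then have "card (E `` {v}) \<le> card ((E `` {v} \<inter> S) \<union> (insert x (set A) \<union> set Q2))"
      using fin by (intro card_mono) auto
    also have "\<dots> \<le> card (E `` {v} \<inter> S) + (k1 + k2)"
      using card_Un_le cAQ by metis
    finally show ?thesis using deg[of v] that SV by auto
  qed
  have deg2: "k1 + k2 \<le> card (E `` {v} \<inter> (S \<union> set Q2))" if "v \<in> S" for v
  proof -
    have "E `` {v} \<subseteq> (E `` {v} \<inter> (S \<union> set Q2)) \<union> insert x (set A)"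
      using nbr[OF that] bS by (auto simp: T Q1)
    then have "card (E `` {v}) \<le> card ((E `` {v} \<inter> (S \<union> set Q2)) \<union> insert x (set A))"
      using fin by (intro card_mono) auto
    also have "\<dots> \<le> card (E `` {v} \<inter> (S \<union> set Q2)) + k1"
      using card_Un_le cA by metis
    finally have "card (E `` {v}) \<le> card (E `` {v} \<inter> (S \<union> set Q2)) + k1" .
    moreover have "2 * (k1 + k2) - 1 \<le> card (E `` {v})" using deg that SV by blast
    moreover have "k1 + k2 + k1 \<le> 2 * (k1 + k2) - 1" using k by simp
    ultimately show ?thesis by linarith
  qed
  obtain R1 where R1: "length R1 = k1" "distinct R1" "set R1 \<subseteq> S - {b}" "walk E (b # R1)"
    using greedy_path[of S _ E b "{b}" k1, OF deg1 irr bS] k by auto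
  have "card (insert b (set R1)) = k1 + 1" using R1 by (simp add: subset_Diff_insert distinct_card)
  \<comment> \<open>The degree inside \<open>S\<close> pays for exactly \<open>k1 + k2\<close>
    vertices, counting \<open>b\<close> and \<open>R1\<close>, so the second branch stops one short
    of \<open>k2\<close>.\<close>
  then obtain R where R: "length R = k2 - 1" "distinct R" "set R \<subseteq> S - insert b (set R1)"
    "walk E (b # R)"
    using greedy_path[of S _ E b "insert b (set R1)" "k2 - 1", OF deg1 irr bS] k by auto
  \<comment> \<open>For \<open>k2 = 1\<close> the list \<open>R\<close> is empty and
    \<open>v\<close> is \<open>b\<close>.\<close>
  define v where "v = last (b # R)"
  define X where "X = insert b (set R1 \<union> set R)"
  have "v = b \<or> v \<in> set R" by (simp add: v_def)
  then have vX: "v \<in> X" and "v \<in> S" using R(3) bS by (auto simp: X_def)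
  have "card X = k1 + k2"
  proof -
    have "set (b # R1 @ R) = X" "distinct (b # R1 @ R)" using R R1 by (auto simp: X_def)
    then have "card X = length (b # R1 @ R)" by (metis distinct_card)
    then show ?thesis using R R1 k by simp
  qed
  \<comment> \<open>The missing last vertex may be taken from \<open>Q2\<close>, which the new stem
    does not use. Of the \<open>k1 + k2\<close> vertices of \<open>X\<close>, \<open>v\<close>
    itself cannot block, so \<open>deg2\<close> just suffices.\<close>
  then have "card (X - {v}) < k1 + k2" using vX k by (simp add: X_def)
  also have "\<dots> \<le> card (E `` {v} \<inter> (S \<union> set Q2))" by (rule deg2[OF \<open>v \<in> S\<close>])
  finally have "\<not> E `` {v} \<inter> (S \<union> set Q2) \<subseteq> X - {v}"
    using card_mono[of "X - {v}"]
    by (metis X_def finite.insertI finite_Diff finite_Un List.finite_set leD)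
  then obtain w where w: "(v, w) \<in> E" "w \<in> S \<union> set Q2" "w \<notin> X" using irr by auto
  have "fork V E k1 k2 (P @ x # A) b R1 (R @ [w])"
    unfolding fork_def
  proof (intro conjI)
    show "length R1 = k1" "length (R @ [w]) = k2" using R1 R k by auto
    have "S \<inter> set (P @ x # A) = {}" using ST SP dist by (auto simp: T Q1)
    then show "distinct ((P @ x # A) @ b # R1 @ R @ [w])"
      using R R1 w dist by (auto simp: X_def Q1)
    show "set ((P @ x # A) @ b # R1 @ R @ [w]) \<subseteq> V"
      using R R1 w sub SV by (auto simp: Q1)
    have "walk E ((P @ x # A) @ [b])" using walks(1) by (simp add: Q1)
    then show "walk E ((P @ x # A) @ b # R1)"
      using R1(4) unfolding successively_append_iff[of _ "P @ x # A"] by simp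
    show "walk E (b # R @ [w])"
      using R(4) w(1) successively_append_iff[of _ "b # R" "[w]"] by (simp add: v_def)
  qed
  then show ?thesis by (intro exI conjI) (assumption, simp)
qed

text \<open>Prolong the first branch up to its first vertex \<open>y\<close> in the set
  \<open>S\<close> reachable from \<open>c\<close>, then the second one from \<open>c\<close> to
  \<open>y\<close>. The latter prolongation stays in \<open>S\<close>, which the former meets only
  in \<open>y\<close>; neither returns to \<open>T\<close>.\<close>

lemma fork_join:
  assumes E: "E \<subseteq> V \<times> V" and k: "k1 \<ge> 1" "k2 \<ge> 1"
    and fork: "fork V E k1 k2 P x Q1 Q2"
    and T: "T = insert x (set Q1 \<union> set Q2)"
    and z: "z \<in> (arcs_off E T)\<^sup>* `` {last Q1}" "z \<in> (arcs_off E T)\<^sup>* `` {last Q2}"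
  shows "contains_subdiv_C V E k1 k2"
proof -
  let ?r = "arcs_off E T"
  define b where "b = last Q1"
  define c where "c = last Q2"
  define S where "S = ?r\<^sup>* `` {c}"
  have len: "length Q1 = k1" "length Q2 = k2"
    and dist: "distinct (P @ x # Q1 @ Q2)" and sub: "set (P @ x # Q1 @ Q2) \<subseteq> V"
    and walks: "walk E (x # Q1)" "walk E (x # Q2)"
    using fork by (auto simp: fork_def successively_append_iff)
  have ne: "Q1 \<noteq> []" "Q2 \<noteq> []" using len k by auto
  have bQ: "b \<in> set Q1" and cQ: "c \<in> set Q2" using ne by (auto simp: b_def c_def)
  have rE: "?r \<subseteq> E" and rT: "Range ?r \<subseteq> V - T" using E by (auto simp: arcs_off_def)
  obtain W1 where W1: "walk ?r (b # W1)" "distinct (b # W1)" "last (b # W1) \<in> S"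
    "set (butlast (b # W1)) \<inter> S = {}"
    by (rule reachable_first_hit[of b z ?r S]) (use z in \<open>simp_all add: b_def c_def S_def\<close>)
  define y where "y = last (b # W1)"
  obtain W2 where W2: "walk ?r (c # W2)" "distinct (c # W2)" "last (c # W2) = y"
    by (rule reachable_first_hit[of c y ?r "{y}"]) (use W1(3) in \<open>simp_all add: S_def y_def\<close>)
  have W1T: "set W1 \<subseteq> V - T" and W2T: "set W2 \<subseteq> V - T"
    using walk_set_subset_Range W1(1) W2(1) rT by fast+
  have W2S: "set W2 \<subseteq> S" using walk_set_subset_reachable[OF W2(1)] by (simp add: S_def)
  \<comment> \<open>\<open>c\<close> is the only vertex of \<open>T\<close> in \<open>S\<close>.
    Hence \<open>W1\<close> is nonempty, which puts \<open>y\<close> outside \<open>T\<close> and in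
    turn makes \<open>W2\<close> nonempty.\<close>
  have "b \<notin> S" using reachable_arcs_off[of b E T c] bQ cQ dist by (auto simp: S_def T)
  then have W1ne: "W1 \<noteq> []" using W1(3) by auto
  then have yW1: "y \<in> set W1" by (simp add: y_def)
  then have yT: "y \<notin> T" using W1T by blast
  then have W2ne: "W2 \<noteq> []" using W2(3) cQ by (auto simp: T)
  then have yW2: "y \<in> set W2" using W2(3) by auto
  have "W1 = butlast W1 @ [y]" using W1ne by (simp add: y_def)
  then have "set W1 = insert y (set (butlast W1))" by (metis Un_insert_right list.simps(15) set_append
        sup_bot.right_neutral list.set(1))
  then have meet: "set W1 \<inter> set W2 = {y}" using W1(4) W1ne W2S yW2 by auto
  define P1 where "P1 = x # Q1 @ W1"
  define P2 where "P2 = x # Q2 @ W2"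
  have "walk E (b # W1)" "walk E (c # W2)" using W1(1) W2(1) rE by (auto intro: walk_mono)
  then have w: "walk E P1" "walk E P2"
    using walks ne W1ne W2ne
    by (auto simp: P1_def P2_def b_def c_def successively_append_iff neq_Nil_conv simp flip: append_Cons)
  have d: "dipath V E P1" "dipath V E P2"
    using w W1 W2 W1T W2T sub dist by (auto simp: dipath_iff_walk P1_def P2_def T)
  have "set P1 \<inter> set P2 = {x, y}"
    using meet W1T W2T dist by (auto simp: P1_def P2_def T)
  moreover have "b \<in> set P1" "b \<notin> set P2" using bQ dist W2T by (auto simp: P1_def P2_def T)
  then have "P1 \<noteq> P2" by blast
  moreover have "x \<noteq> y" using yT by (auto simp: T)
  moreover have "last P1 = y" "last P2 = y"
    using W1ne W2ne W2(3) by (auto simp: P1_def P2_def y_def)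
  moreover have "path_len P1 \<ge> k1" "path_len P2 \<ge> k2"
    using len by (auto simp: path_len_def P1_def P2_def)
  moreover have "hd P1 = x" "hd P2 = x" by (simp_all add: P1_def P2_def)
  ultimately show ?thesis using d unfolding contains_subdiv_C_def by blast
qed

lemma walk_comparable:
  assumes "walk r P" "p \<in> set P" "q \<in> set P"
  shows "(p, q) \<in> r\<^sup>* \<or> (q, p) \<in> r\<^sup>*"
  using assms
proof (induction P)
  case (Cons u P)
  have "set (u # P) \<subseteq> r\<^sup>* `` {u}"
    using walk_set_subset_reachable[OF Cons.prems(1)] by simp
  then have u: "(u, p) \<in> r\<^sup>*" "(u, q) \<in> r\<^sup>*" using Cons.prems by blast+
  have "walk r P" using Cons.prems(1) by (auto simp: successively_Cons)
  then show ?case using u Cons.IH Cons.prems(2,3) by fastforce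
qed simp

theorem theorem24:
  fixes V :: "'a set" and E :: "('a \<times> 'a) set" and k1 k2 :: nat
  assumes "digraph V E"
    and "k1 \<ge> 1" and "k2 \<ge> 1"
    and "min_out_degree V E \<ge> 2 * (k1 + k2) - 1"
  shows "contains_subdiv_C V E k1 k2"
proof -
  have finV: "finite V" and "V \<noteq> {}" and E: "E \<subseteq> V \<times> V" and irr: "\<And>v. (v, v) \<notin> E"
    using assms(1) by (auto simp: digraph_def)
  have deg: "2 * (k1 + k2) - 1 \<le> card (E `` {v})" if "v \<in> V" for v
  proof -
    have "min_out_degree V E \<le> out_degree E v"
      unfolding min_out_degree_def using finV that by (intro Min_le) auto
    moreover have "out_degree E v = card (E `` {v})"
      by (auto simp: out_degree_def intro: arg_cong[of _ _ card])
    ultimately show ?thesis using assms(4) by linarith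
  qed
  define stem where "stem n \<longleftrightarrow> (\<exists>P x Q1 Q2. fork V E k1 k2 P x Q1 Q2 \<and> length P = n)" for n
  obtain x0 where "x0 \<in> V" using \<open>V \<noteq> {}\<close> by blast
  have "\<And>v. v \<in> V \<Longrightarrow> k1 + k2 \<le> card (E `` {v})" using deg assms(2,3) by fastforce
  then have "stem 0" using fork_exists[OF E irr _ \<open>x0 \<in> V\<close>] by (force simp: stem_def)
  moreover have "n \<le> card V" if n: "stem n" for n
  proof -
    obtain P x Q1 Q2 where "fork V E k1 k2 P x Q1 Q2" "length P = n"
      using n unfolding stem_def by blast
    then have "distinct P" "set P \<subseteq> V" "length P = n" by (auto simp: fork_def)
    then show ?thesis using finV by (metis card_mono distinct_card)
  qed
  ultimately obtain n where n: "stem n" and max: "\<And>m. stem m \<Longrightarrow> m \<le> n"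
    using Nat.ex_has_greatest_nat[of stem 0 "card V"] by blast
  then obtain P x Q1 Q2 where F: "fork V E k1 k2 P x Q1 Q2" and "length P = n"
    by (auto simp: stem_def)
  have longest: "\<not> length P < length P'" if "fork V E k1 k2 P' x' Q1' Q2'" for P' x' Q1' Q2'
  proof -
    have "stem (length P')" using that unfolding stem_def by blast
    then show ?thesis using max \<open>length P = n\<close> by fastforce
  qed
  define T where "T = insert x (set Q1 \<union> set Q2)"
  let ?r = "arcs_off E T"
  define S1 where "S1 = ?r\<^sup>* `` {last Q1}"
  define S2 where "S2 = ?r\<^sup>* `` {last Q2}"
  have "S1 \<inter> set P \<noteq> {}"
    using fork_extend[OF E irr finV deg assms(2,3) F T_def S1_def] longest by blast
  then obtain p where p: "p \<in> S1" "p \<in> set P" by blast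
  have T': "T = insert x (set Q2 \<union> set Q1)" by (auto simp: T_def)
  have deg': "v \<in> V \<Longrightarrow> 2 * (k2 + k1) - 1 \<le> card (E `` {v})" for v
    using deg by (simp add: add.commute)
  \<comment> \<open>Swapping the branches keeps the stem, so the maximality of \<open>P\<close> also
    covers forks for \<open>k2\<close>, \<open>k1\<close>.\<close>
  have "S2 \<inter> set P \<noteq> {}"
    using fork_extend[OF E irr finV deg' assms(3,2) fork_swap[OF F] T' S2_def]
      longest fork_swap by metis
  then obtain q where q: "q \<in> S2" "q \<in> set P" by blast
  have "walk E P" "set P \<inter> T = {}" using F by (auto simp: fork_def successively_append_iff T_def)
  \<comment> \<open>\<open>P\<close> avoids \<open>T\<close>, so none of its arcs is removed.
    Whichever of \<open>p\<close> and \<open>q\<close> comes later on \<open>P\<close> is therefore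
    reachable from both branch ends.\<close>
  then have "walk ?r P"
    by (auto simp: arcs_off_def elim!: successively_mono)
  then have "(p, q) \<in> ?r\<^sup>* \<or> (q, p) \<in> ?r\<^sup>*" using p q walk_comparable by metis
  then have "\<exists>z. z \<in> S1 \<and> z \<in> S2"
    using p(1) q(1) unfolding S1_def S2_def Image_singleton_iff by (meson rtrancl_trans)
  then show ?thesis
    using fork_join[OF E assms(2,3) F T_def] unfolding S1_def S2_def by blast
qed

end
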